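(* Let $1\le m<n$ be integers. (i) Let $\mu$ be a measure on $\mathbb{R}$ with finite moments such that $H_k[\mu]\ne0$ for $n-m\le k\le n-1$, and let $\vec{\boldsymbol\nu}_m=(\nu^{(1)},\dots,\nu^{(m)})$ be a vector of (possibly signed or complex) measures on $\mathbb{R}$, each with finite moments. Then $$H_n^B[\mu;\vec{\boldsymbol\nu}_m]=H_{n-m}[\mu]\int_{\mathbb{R}}\cdots\int_{\mathbb{R}}\det\begin{pmatrix}P_{n-m}(z_1)&\cdots&P_{n-m}(z_m)\\ \vdots&\ddots&\vdots\\ P_{n-1}(z_1)&\cdots&P_{n-1}(z_m)\end{pmatrix}\mathrm{d}\nu^{(1)}(z_1)\cdots\mathrm{d}\nu^{(m)}(z_m).$$ (ii) Let $\varphi$ be a finite measure on the unit circle $\mathbb{T}$ such that $D_k[\varphi]\neq0$ for $n-m\le k\le n$, and let $\vec{\boldsymbol\psi}_m=(\psi^{(1)},\dots,\psi^{(m)})$ be a vector of finite (possibly signed or complex) measures on $\mathbb{T}$. Then $$D_n^B[\varphi;\vec{\boldsymbol\psi}_m]=\sqrt{D_{n-m}[\varphi]\,D_{n-m+1}[\varphi]}\int_{\mathbb{T}}\cdots\int_{\mathbb{T}}\det\begin{pmatrix}Q_{n-m}(z_1)&\cdots&Q_{n-m}(z_m)\\ \vdots&\ddots&\vdots\\ Q_{n-1}(z_1)&\cdots&Q_{n-1}(z_m)\end{pmatrix}\prod_{j=1}^m z_j^{-n+1}\,\mathrm{d}\psi^{(j)}(z_j).$$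
   Context: Hankel side. For a measure $\mu$ on $\mathbb{R}$ with finite moments, $\mu_k=\int_{\mathbb{R}}x^k\,\mathrm{d}\mu(x)$ and $H_k[\mu]=\det(\mu_{i+j})_{0\le i,j\le k-1}$; similarly $\nu^{(j)}_k$ is the $k$th moment of $\nu^{(j)}$. When $H_k[\mu]\ne0$, $P_k$ is the monic polynomial of degree $k$ with $\int_{\mathbb{R}}P_k(x)x^j\,\mathrm{d}\mu(x)=0$ for $0\le j\le k-1$. The bordered Hankel determinant is the $n\times n$ determinant $$H_n^B[\mu;\vec{\boldsymbol\nu}_m]=\det\begin{pmatrix}\mu_0&\mu_1&\cdots&\mu_{n-m-1}&\nu^{(1)}_0&\cdots&\nu^{(m)}_0\\ \mu_1&\mu_2&\cdots&\mu_{n-m}&\nu^{(1)}_1&\cdots&\nu^{(m)}_1\\ \vdots&\vdots&\ddots&\vdots&\vdots&\ddots&\vdots\\ \mu_{n-1}&\mu_n&\cdots&\mu_{2n-m-2}&\nu^{(1)}_{n-1}&\cdots&\nu^{(m)}_{n-1}\end{pmatrix}.$$ Toeplitz side. For a finite measure $\varphi$ on $\mathbb{T}$, $\varphi_j=\int_{\mathbb{T}}\zeta^{-j}\,\mathrm{d}\varphi(\zeta)$ ($j\in\mathbb{Z}$), and likewise $\psi^{(i)}_j$ for $\psi^{(i)}$; $D_k[\varphi]=\det(\varphi_{i-j})_{0\le i,j\le k-1}$. The bordered Toeplitz determinant is the $n\times n$ determinant $$D_n^B[\varphi;\vec{\boldsymbol\psi}_m]=\det\begin{pmatrix}\varphi_0&\varphi_1&\cdots&\varphi_{n-m-1}&\psi^{(1)}_{n-1}&\cdots&\psi^{(m)}_{n-1}\\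 \varphi_{-1}&\varphi_0&\cdots&\varphi_{n-m-2}&\psi^{(1)}_{n-2}&\cdots&\psi^{(m)}_{n-2}\\ \vdots&\vdots&\ddots&\vdots&\vdots&\ddots&\vdots\\ \varphi_{-n+1}&\varphi_{-n+2}&\cdots&\varphi_{-m}&\psi^{(1)}_0&\cdots&\psi^{(m)}_0\end{pmatrix}.$$ The biorthonormal polynomials $Q_k$ on the unit circle are given, whenever $D_k[\varphi],D_{k+1}[\varphi]\ne0$, by $$Q_k(z)=\frac{1}{\sqrt{D_k[\varphi]D_{k+1}[\varphi]}}\det\begin{pmatrix}\varphi_0&\varphi_{-1}&\cdots&\varphi_{-k}\\ \varphi_1&\varphi_0&\cdots&\varphi_{-k+1}\\ \vdots&\vdots&\ddots&\vdots\\ \varphi_{k-1}&\varphi_{k-2}&\cdots&\varphi_{-1}\\ 1&z&\cdots&z^k\end{pmatrix}.$$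
   Formalization: In (ii) the factor √(D_{n-m}[φ] D_{n-m+1}[φ]) is replaced by √(D_{n-m}[φ] D_n[φ]); the printed factor is right for m=1 but false in general for m≥2 (e.g. m=2, n=3, φ the sum of unit masses at the fourth roots of unity, ψ^(1)=δ_1, ψ^(2)=δ_i). *)

theory Defs
  imports "HOL-Analysis.Analysis" "Jordan_Normal_Form.Determinant"
begin

section \<open>Signed and complex measures\<close>

text \<open>
  A signed or complex measure on the \<open>\<sigma>\<close>-algebra of \<open>M\<close> is a real- or complex-valued,
  countably additive function on the measurable sets. Only \<open>space M\<close> and \<open>sets M\<close> matter.
\<close>

definition vector_measure :: "'a measure \<Rightarrow> ('a set \<Rightarrow> 'b::real_normed_vector) \<Rightarrow> bool" where
  "vector_measure M \<nu> \<longleftrightarrow>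
     \<nu> {} = 0 \<and>
     (\<forall>A. range A \<subseteq> sets M \<longrightarrow> disjoint_family A \<longrightarrow>
        (\<lambda>i::nat. \<nu> (A i)) sums \<nu> (\<Union>i. A i))"

abbreviation complex_measure :: "'a measure \<Rightarrow> ('a set \<Rightarrow> complex) \<Rightarrow> bool" where
  "complex_measure \<equiv> vector_measure"

text \<open>
  The positive part of the Jordan decomposition of a signed measure \<open>\<nu>\<close> is
  \<open>E \<mapsto> sup {\<nu> F | F \<subseteq> E}\<close>; the negative part is the positive part of \<open>- \<nu>\<close>.
  (Clipping at 0 by \<^const>\<open>ennreal\<close> is harmless as \<open>F = {}\<close> is allowed.)
\<close>

definition pos_part_measure :: "'a measure \<Rightarrow> ('a set \<Rightarrow> real) \<Rightarrow> 'a measure" where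
  "pos_part_measure M \<nu> =
     measure_of (space M) (sets M) (\<lambda>E. SUP F\<in>{F \<in> sets M. F \<subseteq> E}. ennreal (\<nu> F))"

definition cm_integrable ::
    "'a measure \<Rightarrow> ('a set \<Rightarrow> complex) \<Rightarrow> ('a \<Rightarrow> complex) \<Rightarrow> bool" where
  "cm_integrable M \<nu> f \<longleftrightarrow>
     integrable (pos_part_measure M (\<lambda>E. Re (\<nu> E))) f \<and>
     integrable (pos_part_measure M (\<lambda>E. - Re (\<nu> E))) f \<and>
     integrable (pos_part_measure M (\<lambda>E. Im (\<nu> E))) f \<and>
     integrable (pos_part_measure M (\<lambda>E. - Im (\<nu> E))) f"

definition cm_integral ::
    "'a measure \<Rightarrow> ('a set \<Rightarrow> complex) \<Rightarrow> ('a \<Rightarrow> complex) \<Rightarrow> complex" where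
  "cm_integral M \<nu> f =
     (\<integral>x. f x \<partial>pos_part_measure M (\<lambda>E. Re (\<nu> E)))
   - (\<integral>x. f x \<partial>pos_part_measure M (\<lambda>E. - Re (\<nu> E)))
   + \<i> * ((\<integral>x. f x \<partial>pos_part_measure M (\<lambda>E. Im (\<nu> E)))
        - (\<integral>x. f x \<partial>pos_part_measure M (\<lambda>E. - Im (\<nu> E))))"

text \<open>
  \<open>iterated_integral M \<nu> m f\<close> is
  \<open>\<integral> \<cdots> \<integral> f(z) d\<nu>\<^sub>1(z 1) \<cdots> d\<nu>\<^sub>m(z m)\<close>,
  with the integral over \<open>z 1\<close> innermost. Coordinates of \<open>z\<close> outside \<open>{1..m}\<close> are irrelevant.
\<close>

primrec iterated_integral ::
    "'a measure \<Rightarrow> (nat \<Rightarrow> 'a set \<Rightarrow> complex) \<Rightarrow> nat \<Rightarrow> ((nat \<Rightarrow> 'a) \<Rightarrow> complex) \<Rightarrow> complex" where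
  "iterated_integral M \<nu> 0 f = f (\<lambda>_. undefined)"
| "iterated_integral M \<nu> (Suc m) f =
     cm_integral M (\<nu> (Suc m)) (\<lambda>x. iterated_integral M \<nu> m (\<lambda>z. f (z(Suc m := x))))"

text \<open>The following lemmas confirm that \<open>pos_part_measure\<close> yields the Jordan decomposition
  and that \<open>cm_integral\<close> extends the integral with respect to a positive measure.\<close>

lemma vector_measure_Un:
  assumes "vector_measure M \<nu>" "A \<in> sets M" "B \<in> sets M" "A \<inter> B = {}"
  shows "\<nu> (A \<union> B) = \<nu> A + \<nu> B"
proof -
  have 0: "\<nu> {} = 0" using assms by (simp add: vector_measure_def)
  have d: "disjoint_family (binaryset A B)"
    using assms(4) by (auto simp: disjoint_family_on_def binaryset_def)
  have "range (binaryset A B) \<subseteq> sets M"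
    using assms by (auto simp: range_binaryset_eq)
  with d assms(1) have "(\<lambda>i. \<nu> (binaryset A B i)) sums \<nu> (\<Union>i. binaryset A B i)"
    unfolding vector_measure_def by blast
  moreover have "(\<lambda>i. \<nu> (binaryset A B i)) sums (\<nu> A + \<nu> B)"
    by (rule binaryset_sums[of \<nu>, OF 0])
  ultimately show ?thesis by (simp add: UN_binaryset_eq sums_unique2)
qed

lemma vector_measure_Diff:
  assumes "vector_measure M \<nu>" "A \<in> sets M" "B \<in> sets M" "B \<subseteq> A"
  shows "\<nu> (A - B) = \<nu> A - \<nu> B"
proof -
  have "\<nu> (B \<union> (A - B)) = \<nu> B + \<nu> (A - B)"
    using assms by (intro vector_measure_Un) auto
  moreover have "B \<union> (A - B) = A" using assms(4) by auto
  ultimately show ?thesis by simp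
qed

lemma vector_measure_linear:
  assumes "vector_measure M \<nu>" "bounded_linear h"
  shows "vector_measure M (\<lambda>E. h (\<nu> E))"
  using assms unfolding vector_measure_def
  by (auto intro: bounded_linear.sums simp: linear_simps)

lemma signed_measure_bdd_above:
  fixes \<nu> :: "'a set \<Rightarrow> real"
  assumes "vector_measure M \<nu>"
  shows "bdd_above (\<nu> ` sets M)"
proof (rule ccontr)
  define B where "B E \<longleftrightarrow> bdd_above (\<nu> ` {F \<in> sets M. F \<subseteq> E})" for E
  assume "\<not> ?thesis"
  moreover have "{F \<in> sets M. F \<subseteq> space M} = sets M"
    using sets.sets_into_space by auto
  ultimately have base: "space M \<in> sets M \<and> \<not> B (space M)" unfolding B_def by simp
  have step: "\<exists>E'. (E' \<in> sets M \<and> \<not> B E') \<and> E' \<subseteq> E \<and> \<bar>\<nu> (E - E')\<bar> \<ge> 1"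
    if E: "E \<in> sets M \<and> \<not> B E" for E
  proof -
    obtain F where F: "F \<in> sets M" "F \<subseteq> E" "\<nu> F > 1 + \<bar>\<nu> E\<bar>"
      using E unfolding B_def bdd_above_def by (force simp: not_le)
    have D: "\<nu> (E - F) = \<nu> E - \<nu> F" using vector_measure_Diff[OF assms] E F by auto
    have "\<not> B F \<or> \<not> B (E - F)"
    proof (rule ccontr)
      assume "\<not> ?thesis"
      then obtain a b where a: "\<And>G. G \<in> sets M \<Longrightarrow> G \<subseteq> F \<Longrightarrow> \<nu> G \<le> a"
        and b: "\<And>G. G \<in> sets M \<Longrightarrow> G \<subseteq> E - F \<Longrightarrow> \<nu> G \<le> b"
        unfolding B_def bdd_above_def by force
      have "\<nu> G \<le> a + b" if G: "G \<in> sets M" "G \<subseteq> E" for G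
      proof -
        have "\<nu> ((G \<inter> F) \<union> (G - F)) = \<nu> (G \<inter> F) + \<nu> (G - F)"
          using G F by (intro vector_measure_Un[OF assms]) auto
        moreover have "(G \<inter> F) \<union> (G - F) = G" by auto
        moreover have "\<nu> (G \<inter> F) \<le> a" using G F by (intro a) auto
        moreover have "\<nu> (G - F) \<le> b" using G F by (intro b) auto
        ultimately show ?thesis by simp
      qed
      then have "B E" unfolding B_def bdd_above_def by auto
      with E show False by simp
    qed
    then show ?thesis
    proof
      assume "\<not> B F"
      then show ?thesis using F D by (intro exI[of _ F]) auto
    next
      assume "\<not> B (E - F)"
      moreover have "E - (E - F) = F" using F by auto
      ultimately show ?thesis using F E by (intro exI[of _ "E - F"]) auto
    qed
  qed
  obtain E :: "nat \<Rightarrow> 'a set" where E: "\<And>n. E n \<in> sets M \<and> \<not> B (E n)"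
      "\<And>n. E (Suc n) \<subseteq> E n \<and> \<bar>\<nu> (E n - E (Suc n))\<bar> \<ge> 1"
    using dependent_nat_choice[of "\<lambda>_ E. E \<in> sets M \<and> \<not> B E"
        "\<lambda>_ E E'. E' \<subseteq> E \<and> \<bar>\<nu> (E - E')\<bar> \<ge> 1"] base step by blast
  have dec: "decseq E" using E(2) by (auto simp: decseq_Suc_iff)
  define A where "A n = E n - E (Suc n)" for n
  have "disjoint_family A"
    unfolding disjoint_family_on_def
  proof (intro ballI impI)
    fix i j :: nat assume "i \<noteq> j"
    then consider "Suc i \<le> j" | "Suc j \<le> i" by linarith
    then show "A i \<inter> A j = {}"
      by cases (use decseqD[OF dec] in \<open>fastforce simp: A_def\<close>)+
  qed
  moreover have "range A \<subseteq> sets M" using E(1) by (auto simp: A_def)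
  ultimately have "(\<lambda>i. \<nu> (A i)) sums \<nu> (\<Union>i. A i)"
    using assms unfolding vector_measure_def by blast
  then have "(\<lambda>i. \<nu> (A i)) \<longlonglongrightarrow> 0" by (intro summable_LIMSEQ_zero) (rule sums_summable)
  then have "\<forall>\<^sub>F i in sequentially. \<bar>\<nu> (A i)\<bar> < 1"
    by (auto dest: tendstoD[where e = 1] simp: dist_real_def)
  then obtain i where "\<bar>\<nu> (A i)\<bar> < 1" by (auto simp: eventually_sequentially)
  with E(2)[of i] show False by (simp add: A_def)
qed

lemma space_pos_part_measure [simp]: "space (pos_part_measure M \<nu>) = space M"
  and sets_pos_part_measure [simp, measurable_cong]: "sets (pos_part_measure M \<nu>) = sets M"
  unfolding pos_part_measure_def by auto

lemma emeasure_pos_part_measure: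
  fixes \<nu> :: "'a set \<Rightarrow> real"
  assumes "vector_measure M \<nu>" "E \<in> sets M"
  shows "emeasure (pos_part_measure M \<nu>) E = (SUP F\<in>{F \<in> sets M. F \<subseteq> E}. ennreal (\<nu> F))"
proof -
  define P where "P E = (SUP F\<in>{F \<in> sets M. F \<subseteq> E}. ennreal (\<nu> F))" for E
  have \<nu>0: "\<nu> {} = 0" using assms(1) by (simp add: vector_measure_def)
  have upper: "ennreal (\<nu> F) \<le> P E" if "F \<in> sets M" "F \<subseteq> E" for F E
    unfolding P_def using that by (intro SUP_upper) auto
  have ex: "\<exists>F'\<in>sets M. F' \<subseteq> F \<and> \<nu> F' \<ge> 0 \<and> ennreal (\<nu> F') = ennreal (\<nu> F)" if "F \<in> sets M" for F
  proof (cases "\<nu> F \<ge> 0")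
    case False
    then show ?thesis by (intro bexI[of _ "{}"]) (auto simp: \<nu>0 ennreal_neg)
  qed (use that in auto)
  have P_Un: "P A + P B \<le> P (A \<union> B)" if AB: "A \<inter> B = {}" for A B
  proof -
    have 1: "ennreal (\<nu> F) + ennreal (\<nu> G) \<le> P (A \<union> B)"
      if FG: "F \<in> sets M" "F \<subseteq> A" "G \<in> sets M" "G \<subseteq> B" for F G
    proof -
      obtain F' where F': "F' \<in> sets M" "F' \<subseteq> F" "\<nu> F' \<ge> 0" "ennreal (\<nu> F') = ennreal (\<nu> F)"
        using ex[OF FG(1)] by blast
      obtain G' where G': "G' \<in> sets M" "G' \<subseteq> G" "\<nu> G' \<ge> 0" "ennreal (\<nu> G') = ennreal (\<nu> G)"
        using ex[OF FG(3)] by blast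
      have "\<nu> (F' \<union> G') = \<nu> F' + \<nu> G'"
        using F' G' FG AB by (intro vector_measure_Un[OF assms(1)]) blast+
      then have "ennreal (\<nu> F) + ennreal (\<nu> G) = ennreal (\<nu> (F' \<union> G'))"
        using F' G' by (metis ennreal_plus)
      also have "\<dots> \<le> P (A \<union> B)" using F' G' FG by (intro upper) auto
      finally show ?thesis .
    qed
    have 2: "ennreal (\<nu> F) + P B \<le> P (A \<union> B)" if F: "F \<in> sets M" "F \<subseteq> A" for F
    proof -
      have "ennreal (\<nu> F) + P B = (SUP G\<in>{G \<in> sets M. G \<subseteq> B}. ennreal (\<nu> F) + ennreal (\<nu> G))"
        unfolding P_def by (rule ennreal_SUP_add_right) auto
      also have "\<dots> \<le> P (A \<union> B)" using 1 F by (intro SUP_least) auto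
      finally show ?thesis .
    qed
    have "P A + P B = (SUP F\<in>{F \<in> sets M. F \<subseteq> A}. ennreal (\<nu> F) + P B)"
      unfolding P_def[of A] by (rule ennreal_SUP_add_left[symmetric]) auto
    also have "\<dots> \<le> P (A \<union> B)" using 2 by (intro SUP_least) auto
    finally show ?thesis .
  qed
  have "{F \<in> sets M. F \<subseteq> {}} = {{}}" by auto
  then have P0: "P {} = 0" unfolding P_def by (simp add: \<nu>0)
  have mono: "P A \<le> P B" if "A \<subseteq> B" for A B
    unfolding P_def using that by (intro SUP_subset_mono) auto
  have ca: "countably_additive (sets M) P"
  proof (rule countably_additiveI)
    fix A :: "nat \<Rightarrow> 'a set"
    assume A: "range A \<subseteq> sets M" "disjoint_family A" "(\<Union>i. A i) \<in> sets M"
    have "(\<Sum>i<n. P (A i)) \<le> P (\<Union>i<n. A i)" for n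
    proof (induction n)
      case (Suc n)
      have "(\<Union>i<n. A i) \<inter> A n = {}"
        using disjoint_family_onD[OF A(2), of _ n] by fastforce
      then have "P (\<Union>i<n. A i) + P (A n) \<le> P ((\<Union>i<n. A i) \<union> A n)" by (rule P_Un)
      moreover have "(\<Union>i<n. A i) \<union> A n = (\<Union>i<Suc n. A i)" by (auto simp: less_Suc_eq)
      moreover have "(\<Sum>i<Suc n. P (A i)) \<le> P (\<Union>i<n. A i) + P (A n)"
        using Suc by (simp add: add_right_mono)
      ultimately show ?case by (metis order.trans)
    qed (simp add: P0)
    moreover have "P (\<Union>i<n. A i) \<le> P (\<Union>i. A i)" for n by (intro mono) auto
    ultimately have "(\<Sum>i<n. P (A i)) \<le> P (\<Union>i. A i)" for n by (rule order.trans)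
    then have le: "(\<Sum>i. P (A i)) \<le> P (\<Union>i. A i)"
      unfolding suminf_eq_SUP by (rule SUP_least)
    have "ennreal (\<nu> F) \<le> (\<Sum>i. P (A i))" if F: "F \<in> sets M" "F \<subseteq> (\<Union>i. A i)" for F
    proof -
      have "disjoint_family (\<lambda>i. F \<inter> A i)"
        using A(2) by (rule disjoint_family_on_bisimulation) auto
      moreover have "range (\<lambda>i. F \<inter> A i) \<subseteq> sets M" using A(1) F(1) by auto
      ultimately have "(\<lambda>i. \<nu> (F \<inter> A i)) sums \<nu> (\<Union>i. F \<inter> A i)"
        using assms(1) unfolding vector_measure_def by blast
      moreover have "(\<Union>i. F \<inter> A i) = F" using F(2) by auto
      ultimately have "(\<lambda>n. \<Sum>i<n. \<nu> (F \<inter> A i)) \<longlonglongrightarrow> \<nu> F" by (simp add: sums_def)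
      then have "(\<lambda>n. ennreal (\<Sum>i<n. \<nu> (F \<inter> A i))) \<longlonglongrightarrow> ennreal (\<nu> F)"
        by (rule tendsto_ennrealI)
      moreover have "ennreal (\<Sum>i<n. \<nu> (F \<inter> A i)) \<le> (\<Sum>i. P (A i))" for n
      proof -
        have "ennreal (\<Sum>i<n. \<nu> (F \<inter> A i)) \<le> ennreal (\<Sum>i<n. max 0 (\<nu> (F \<inter> A i)))"
          by (intro ennreal_leI sum_mono) auto
        also have "\<dots> = (\<Sum>i<n. ennreal (max 0 (\<nu> (F \<inter> A i))))"
          by (rule sum_ennreal[symmetric]) auto
        also have "\<dots> = (\<Sum>i<n. ennreal (\<nu> (F \<inter> A i)))"
          by (intro sum.cong refl) (simp add: max_def ennreal_neg)
        also have "\<dots> \<le> (\<Sum>i<n. P (A i))"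
          using A(1) F(1) by (intro sum_mono upper) auto
        also have "\<dots> \<le> (\<Sum>i. P (A i))" by (rule sum_le_suminf) auto
        finally show ?thesis .
      qed
      ultimately show ?thesis by (intro LIMSEQ_le_const2) auto
    qed
    then have "P (\<Union>i. A i) \<le> (\<Sum>i. P (A i))"
      unfolding P_def[of "\<Union>i. A i"] by (intro SUP_least) auto
    with le show "(\<Sum>i. P (A i)) = P (\<Union>i. A i)" by (rule antisym)
  qed
  have "emeasure (pos_part_measure M \<nu>) E = P E"
  proof (rule emeasure_measure_of)
    show "pos_part_measure M \<nu> = measure_of (space M) (sets M) P"
      by (simp add: pos_part_measure_def P_def[abs_def])
    show "sets M \<subseteq> Pow (space M)" by (rule sets.space_closed)
    show "positive (sets (pos_part_measure M \<nu>)) P" using P0 by (simp add: positive_def)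
    show "countably_additive (sets (pos_part_measure M \<nu>)) P" using ca by simp
    show "E \<in> sets (pos_part_measure M \<nu>)" using assms(2) by simp
  qed
  then show ?thesis by (simp add: P_def)
qed

lemma finite_measure_pos_part_measure:
  fixes \<nu> :: "'a set \<Rightarrow> real"
  assumes "vector_measure M \<nu>"
  shows "finite_measure (pos_part_measure M \<nu>)"
proof
  obtain c where c: "\<And>F. F \<in> sets M \<Longrightarrow> \<nu> F \<le> c"
    using signed_measure_bdd_above[OF assms] unfolding bdd_above_def by auto
  have "emeasure (pos_part_measure M \<nu>) (space M) \<le> ennreal c"
    by (subst emeasure_pos_part_measure[OF assms]) (auto intro!: SUP_least ennreal_leI c)
  also have "\<dots> < \<infinity>" by simp
  finally show "emeasure (pos_part_measure M \<nu>) (space (pos_part_measure M \<nu>)) \<noteq> \<infinity>" by simp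
qed

lemma jordan_decomposition:
  fixes \<nu> :: "'a set \<Rightarrow> real"
  assumes "vector_measure M \<nu>" "E \<in> sets M"
  shows "\<nu> E = measure (pos_part_measure M \<nu>) E - measure (pos_part_measure M (\<lambda>E. - \<nu> E)) E"
proof -
  have le: "\<nu> F + measure (pos_part_measure M (\<lambda>E. - \<nu> E)) E \<ge> measure (pos_part_measure M \<nu>) E"
    if "vector_measure M \<nu>" "F = E" for \<nu> :: "'a set \<Rightarrow> real" and F
  proof -
    have m: "vector_measure M (\<lambda>E. - \<nu> E)"
      by (rule vector_measure_linear[OF that(1)]) (rule bounded_linear_minus[OF bounded_linear_ident])
    interpret N: finite_measure "pos_part_measure M (\<lambda>E. - \<nu> E)"
      by (rule finite_measure_pos_part_measure[OF m])
    interpret P: finite_measure "pos_part_measure M \<nu>"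
      by (rule finite_measure_pos_part_measure[OF that(1)])
    have *: "ennreal (\<nu> G) \<le> ennreal (\<nu> E + measure (pos_part_measure M (\<lambda>E. - \<nu> E)) E)"
      if G: "G \<in> sets M" "G \<subseteq> E" for G
    proof -
      have "ennreal (- \<nu> (E - G)) \<le> emeasure (pos_part_measure M (\<lambda>E. - \<nu> E)) E"
        using G assms(2) by (subst emeasure_pos_part_measure[OF m]) (auto intro: SUP_upper)
      then have "- \<nu> (E - G) \<le> measure (pos_part_measure M (\<lambda>E. - \<nu> E)) E"
        by (simp add: N.emeasure_eq_measure ennreal_le_iff)
      moreover have "\<nu> (E - G) = \<nu> E - \<nu> G"
        using G assms(2) \<open>vector_measure M \<nu>\<close> by (intro vector_measure_Diff) auto
      ultimately show ?thesis by (intro ennreal_leI) auto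
    qed
    have "- \<nu> E \<le> measure (pos_part_measure M (\<lambda>E. - \<nu> E)) E"
    proof -
      have "ennreal (- \<nu> E) \<le> emeasure (pos_part_measure M (\<lambda>E. - \<nu> E)) E"
        using assms(2) by (subst emeasure_pos_part_measure[OF m]) (auto intro: SUP_upper)
      then show ?thesis by (simp add: N.emeasure_eq_measure ennreal_le_iff)
    qed
    moreover have "emeasure (pos_part_measure M \<nu>) E
        \<le> ennreal (\<nu> E + measure (pos_part_measure M (\<lambda>E. - \<nu> E)) E)"
      using * by (subst emeasure_pos_part_measure[OF that(1) assms(2)]) (auto intro: SUP_least)
    ultimately show ?thesis using that(2)
      by (simp add: P.emeasure_eq_measure ennreal_le_iff)
  qed
  have m: "vector_measure M (\<lambda>E. - \<nu> E)"
    by (rule vector_measure_linear[OF assms(1)]) (rule bounded_linear_minus[OF bounded_linear_ident])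
  show ?thesis using le[OF assms(1) refl] le[OF m refl] by simp
qed

lemma pos_part_measure_of_measure:
  assumes "finite_measure N"
  shows "pos_part_measure N (measure N) = N"
    and "pos_part_measure N (\<lambda>E. - measure N E) = null_measure N"
    and "pos_part_measure N (\<lambda>E. 0) = null_measure N"
proof -
  interpret finite_measure N by fact
  have v: "vector_measure N (measure N)"
    unfolding vector_measure_def by (auto intro!: finite_measure_UNION)
  have v': "vector_measure N (\<lambda>E. - measure N E)" "vector_measure N (\<lambda>E. 0 :: real)"
    by (rule vector_measure_linear[OF v, of uminus], rule bounded_linear_minus[OF bounded_linear_ident])
       (simp add: vector_measure_def)
  show "pos_part_measure N (measure N) = N"
  proof (rule measure_eqI)
    fix E assume "E \<in> sets (pos_part_measure N (measure N))"
    then have E: "E \<in> sets N" by simp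
    have "(SUP F\<in>{F \<in> sets N. F \<subseteq> E}. ennreal (measure N F)) = ennreal (measure N E)"
      using E by (intro antisym SUP_least SUP_upper) (auto intro!: ennreal_leI finite_measure_mono)
    then show "emeasure (pos_part_measure N (measure N)) E = emeasure N E"
      by (simp add: emeasure_pos_part_measure[OF v E] emeasure_eq_measure)
  qed simp
  have z: "pos_part_measure N \<nu> = null_measure N"
    if v: "vector_measure N \<nu>" and le: "\<And>E. \<nu> E \<le> 0" for \<nu>
  proof (rule measure_eqI)
    fix E assume "E \<in> sets (pos_part_measure N \<nu>)"
    then have E: "E \<in> sets N" by simp
    show "emeasure (pos_part_measure N \<nu>) E = emeasure (null_measure N) E"
      unfolding emeasure_pos_part_measure[OF v E]
      by (auto simp: ennreal_neg le intro!: antisym SUP_least)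
  qed simp
  show "pos_part_measure N (\<lambda>E. - measure N E) = null_measure N"
    by (rule z[OF v'(1)]) simp
  show "pos_part_measure N (\<lambda>E. 0) = null_measure N"
    by (rule z[OF v'(2)]) simp
qed

lemma cm_integral_of_measure:
  assumes "finite_measure N"
  shows "cm_integral N (\<lambda>E. complex_of_real (measure N E)) f = (\<integral>x. f x \<partial>N)"
  by (simp add: cm_integral_def pos_part_measure_of_measure[OF assms])

section \<open>Hankel determinants\<close>

definition hankel_det :: "real measure \<Rightarrow> nat \<Rightarrow> real" where
  "hankel_det \<mu> k = Determinant.det (Matrix.mat k k (\<lambda>(i, j). \<integral>x. x ^ (i + j) \<partial>\<mu>))"

definition orth_poly :: "real measure \<Rightarrow> nat \<Rightarrow> real poly" where
  "orth_poly \<mu> k =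
     (THE P. degree P = k \<and> lead_coeff P = 1 \<and> (\<forall>j<k. (\<integral>x. poly P x * x ^ j \<partial>\<mu>) = 0))"

text \<open>Rows and columns are indexed from 0 while the measures are \<open>\<nu> 1, \<dots>, \<nu> m\<close>.\<close>

definition bordered_hankel_det ::
    "real measure \<Rightarrow> (nat \<Rightarrow> real set \<Rightarrow> complex) \<Rightarrow> nat \<Rightarrow> nat \<Rightarrow> complex" where
  "bordered_hankel_det \<mu> \<nu> m n =
     Determinant.det (Matrix.mat n n (\<lambda>(i, j).
       if j < n - m then complex_of_real (\<integral>x. x ^ (i + j) \<partial>\<mu>)
       else cm_integral borel (\<nu> (j - (n - m) + 1)) (\<lambda>x. complex_of_real x ^ i)))"

section \<open>Toeplitz determinants\<close>

abbreviation circle_borel :: "complex measure" where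
  "circle_borel \<equiv> restrict_space borel (sphere 0 1)"

definition circle_moment :: "complex measure \<Rightarrow> int \<Rightarrow> complex" where
  "circle_moment \<phi> j = (\<integral>\<zeta>. \<zeta> powi (- j) \<partial>\<phi>)"

definition toeplitz_det :: "complex measure \<Rightarrow> nat \<Rightarrow> complex" where
  "toeplitz_det \<phi> k =
     Determinant.det (Matrix.mat k k (\<lambda>(i, j). circle_moment \<phi> (int i - int j)))"

text \<open>For a (positive) measure the Toeplitz determinants are nonnegative reals, so
  \<^const>\<open>csqrt\<close> is the usual square root here. The leading coefficient of
  \<open>circle_poly \<phi> k\<close> is \<open>sqrt (D\<^sub>k / D\<^sub>k\<^sub>+\<^sub>1)\<close>; the product over \<open>n - m \<le> k < n\<close>
  telescopes to \<open>sqrt (D\<^sub>n\<^sub>-\<^sub>m / D\<^sub>n)\<close>, which is why the integral formula for the bordered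
  determinant carries the factor \<open>sqrt (D\<^sub>n\<^sub>-\<^sub>m * D\<^sub>n)\<close>. A factor \<open>sqrt (D\<^sub>n\<^sub>-\<^sub>m * D\<^sub>n\<^sub>-\<^sub>m\<^sub>+\<^sub>1)\<close>
  is correct only for \<open>m = 1\<close>.\<close>

definition circle_poly :: "complex measure \<Rightarrow> nat \<Rightarrow> complex \<Rightarrow> complex" where
  "circle_poly \<phi> k z =
     1 / csqrt (toeplitz_det \<phi> k * toeplitz_det \<phi> (k + 1)) *
     Determinant.det (Matrix.mat (k + 1) (k + 1) (\<lambda>(i, j).
       if i < k then circle_moment \<phi> (int i - int j) else z ^ j))"

definition bordered_toeplitz_det ::
    "complex measure \<Rightarrow> (nat \<Rightarrow> complex set \<Rightarrow> complex) \<Rightarrow> nat \<Rightarrow> nat \<Rightarrow> complex" where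
  "bordered_toeplitz_det \<phi> \<psi> m n =
     Determinant.det (Matrix.mat n n (\<lambda>(i, j).
       if j < n - m then circle_moment \<phi> (int j - int i)
       else cm_integral circle_borel (\<psi> (j - (n - m) + 1))
              (\<lambda>\<zeta>. \<zeta> powi (- (int n - 1 - int i)))))"

end

theory Submission
  imports Defs "Jordan_Normal_Form.Char_Poly"
begin

text \<open>
  Replacing row \<open>k \<ge> n - m\<close> of a bordered determinant by the combination of the rows \<open>0, \<dots>, k\<close>
  with the coefficients of the \<open>k\<close>th orthogonal polynomial annihilates, by orthogonality, the
  entries in the first \<open>n - m\<close> columns. The matrix becomes block upper triangular, and the entries
  of the lower right block are the integrals of the orthogonal polynomials against the border measures;
  its determinant is the iterated integral by the Leibniz formula. In the Toeplitz case the row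
  operations multiply the determinant by the product of the leading coefficients, which telescopes
  because the Toeplitz determinants of a positive measure are nonnegative.
\<close>

section \<open>Determinants: block reduction, bordered rows and nonnegative quadratic forms\<close>

text \<open>The row operations are left multiplication by a lower triangular matrix with diagonal
  entry 1 in the first d rows and \<open>c k k\<close> afterwards; \<open>ann\<close> says that the
  lower left block of the result is zero. Keeping the product of the \<open>c k k\<close> on the
  left avoids division.\<close>

lemma det_mult_block_reduce:
  fixes A :: "'a::idom Matrix.mat"
  assumes A: "A \<in> carrier_mat n n" and d: "d \<le> n"
    and ann: "\<And>k j. d \<le> k \<Longrightarrow> k < n \<Longrightarrow> j < d \<Longrightarrow> (\<Sum>l\<le>k. c k l * A $$ (l, j)) = 0"
  shows "(\<Prod>k=d..<n. c k k) * Determinant.det A =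
    Determinant.det (Matrix.mat d d (\<lambda>(i, j). A $$ (i, j))) *
    Determinant.det (Matrix.mat (n - d) (n - d) (\<lambda>(i, j). \<Sum>l\<le>d + i. c (d + i) l * A $$ (l, d + j)))"
proof -
  define L where "L = Matrix.mat n n (\<lambda>(i, l). if i < d then of_bool (i = l) else of_bool (l \<le> i) * c i l)"
  have L: "L \<in> carrier_mat n n" by (simp add: L_def)
  have "Determinant.det L = prod_list (diag_mat L)"
    by (rule det_lower_triangular[OF _ L]) (auto simp: L_def)
  also have "\<dots> = (\<Prod>i=0..<n. if i < d then 1 else c i i)"
    unfolding prod_list_diag_prod by (auto simp: L_def intro!: prod.cong)
  also have "\<dots> = (\<Prod>i=0..<d. if i < d then 1 else c i i) * (\<Prod>i=d..<n. if i < d then 1 else c i i)"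
    using d by (intro prod.atLeastLessThan_concat[symmetric]) auto
  also have "\<dots> = (\<Prod>k=d..<n. c k k)" by simp
  finally have detL: "Determinant.det L = (\<Prod>k=d..<n. c k k)" .
  have LA: "(L * A) $$ (i, j) = (if i < d then A $$ (i, j) else \<Sum>l\<le>i. c i l * A $$ (l, j))"
    if "i < n" "j < n" for i j
  proof -
    have "(L * A) $$ (i, j) = (\<Sum>l=0..<n. L $$ (i, l) * A $$ (l, j))"
      using that A L by (simp add: scalar_prod_def)
    also have "\<dots> = (\<Sum>l=0..<n. (if i < d then of_bool (i = l) else of_bool (l \<le> i) * c i l) * A $$ (l, j))"
      using that by (intro sum.cong) (auto simp: L_def)
    also have "\<dots> = (if i < d then A $$ (i, j) else \<Sum>l\<le>i. c i l * A $$ (l, j))"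
    proof (cases "i < d")
      case True
      then show ?thesis using that by (simp add: of_bool_def if_distrib[of "\<lambda>x. x * _"] sum.delta cong: if_cong)
    next
      case False
      have "(\<Sum>l=0..<n. of_bool (l \<le> i) * c i l * A $$ (l, j)) = (\<Sum>l\<le>i. c i l * A $$ (l, j))"
        using that by (intro sum.mono_neutral_cong_right) auto
      with False show ?thesis by simp
    qed
    finally show ?thesis .
  qed
  let ?B1 = "Matrix.mat d d (\<lambda>(i, j). A $$ (i, j))"
  let ?B2 = "Matrix.mat d (n - d) (\<lambda>(i, j). A $$ (i, d + j))"
  let ?B4 = "Matrix.mat (n - d) (n - d) (\<lambda>(i, j). \<Sum>l\<le>d + i. c (d + i) l * A $$ (l, d + j))"
  have "L * A = four_block_mat ?B1 ?B2 (0\<^sub>m (n - d) d) ?B4"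
  proof (rule eq_matI)
    fix i j
    assume "i < dim_row (four_block_mat ?B1 ?B2 (0\<^sub>m (n - d) d) ?B4)"
      "j < dim_col (four_block_mat ?B1 ?B2 (0\<^sub>m (n - d) d) ?B4)"
    then have ij: "i < n" "j < n" using d by auto
    show "(L * A) $$ (i, j) = four_block_mat ?B1 ?B2 (0\<^sub>m (n - d) d) ?B4 $$ (i, j)"
      unfolding LA[OF ij] using ij d ann[of i j] by (subst index_mat_four_block) auto
  qed (use A L d in auto)
  then have "Determinant.det (L * A) = Determinant.det ?B1 * Determinant.det ?B4"
    by (simp only: det_four_block_mat_lower_left_zero[OF mat_carrier mat_carrier refl mat_carrier])
  moreover have "Determinant.det (L * A) = Determinant.det L * Determinant.det A"
    by (rule det_mult[OF L A])
  ultimately show ?thesis unfolding detL by simp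
qed

text \<open>Cofactor of the entry in row k and column j of a matrix of size k + 1 whose first k rows
  are given by \<open>a\<close>; the conditional skips column j. Since \<open>a\<close> is a
  function and not a matrix, k may vary with \<open>a\<close> fixed.\<close>

definition border_coeff :: "nat \<Rightarrow> (nat \<Rightarrow> nat \<Rightarrow> 'a::comm_ring_1) \<Rightarrow> nat \<Rightarrow> 'a" where
  "border_coeff k a j = (- 1) ^ (k + j) *
     Determinant.det (Matrix.mat k k (\<lambda>(i, l). a i (if l < j then l else Suc l)))"

text \<open>Laplace expansion along the last row, whose cofactors do not involve \<open>r\<close>.
  For \<open>r j = z ^ j\<close> this reads off the coefficients of a polynomial given by a
  determinant.\<close>

lemma det_border_row:
  "Determinant.det (Matrix.mat (k + 1) (k + 1) (\<lambda>(i, j). if i < k then a i j else r j)) =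
   (\<Sum>j\<le>k. border_coeff k a j * r j)"
proof -
  let ?A = "Matrix.mat (k + 1) (k + 1) (\<lambda>(i, j). if i < k then a i j else r j)"
  have "Determinant.det ?A = (\<Sum>j<k + 1. ?A $$ (k, j) * cofactor ?A k j)"
    by (rule laplace_expansion_row) auto
  also have "\<dots> = (\<Sum>j<k + 1. border_coeff k a j * r j)"
  proof (rule sum.cong)
    fix j assume "j \<in> {..<k + 1}"
    moreover from this have "mat_delete ?A k j = Matrix.mat k k (\<lambda>(i, l). a i (if l < j then l else Suc l))"
      by (intro eq_matI) (auto simp: mat_delete_def)
    ultimately show "?A $$ (k, j) * cofactor ?A k j = border_coeff k a j * r j"
      by (simp add: cofactor_def border_coeff_def mult.commute)
  qed simp
  finally show ?thesis by (simp add: lessThan_Suc_atMost)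
qed

text \<open>Skipping the last column leaves the leading block, and the sign is an even power of
  -1.\<close>

lemma border_coeff_lead:
  "border_coeff k a k = Determinant.det (Matrix.mat k k (\<lambda>(i, j). a i j))"
proof -
  have "Matrix.mat k k (\<lambda>(i, l). a i (if l < k then l else Suc l)) = Matrix.mat k k (\<lambda>(i, j). a i j)"
    by (intro eq_matI) auto
  then show ?thesis by (simp add: border_coeff_def flip: mult_2)
qed

text \<open>Putting row \<open>l\<close> in place of the last row produces two equal rows. With
  moments as entries this is the orthogonality relation.\<close>

lemma border_coeff_orth:
  assumes "l < k"
  shows "(\<Sum>j\<le>k. border_coeff k a j * a l j) = 0"
  unfolding det_border_row[symmetric]
  using assms
  by (intro det_identical_rows[where i = l and j = k and n = "k + 1"]) (auto simp: Matrix.row_def)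

text \<open>Over the complex numbers the determinant is the product of the eigenvalues with
  multiplicity, and the quadratic form forces each eigenvalue to be a nonnegative real.\<close>

lemma det_in_nonneg_Reals:
  assumes A: "A \<in> carrier_mat n n"
    and psd: "\<And>v :: nat \<Rightarrow> complex.
      (\<Sum>i<n. \<Sum>j<n. cnj (v i) * A $$ (i, j) * v j) \<in> \<real>\<^sub>\<ge>\<^sub>0"
  shows "Determinant.det A \<in> \<real>\<^sub>\<ge>\<^sub>0"
proof -
  obtain es where es: "char_poly A = (\<Prod>a\<leftarrow>es. [:- a, 1:])" "length es = n"
    using char_poly_factorized[OF A] by auto
  have ev: "e \<in> \<real>\<^sub>\<ge>\<^sub>0" if "e \<in> set es" for e
  proof -
    have "poly (char_poly A) e = 0"
      using that unfolding es by (simp add: poly_prod_list prod_list_zero_iff image_iff)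
    then have "eigenvalue A e" by (simp add: eigenvalue_root_char_poly[OF A])
    then obtain v where v: "v \<in> carrier_vec n" "v \<noteq> 0\<^sub>v n" "A *\<^sub>v v = e \<cdot>\<^sub>v v"
      using A unfolding eigenvalue_def eigenvector_def by auto
    have row: "(\<Sum>j<n. A $$ (i, j) * vec_index v j) = e * vec_index v i" if "i < n" for i
      using arg_cong[OF v(3), of "\<lambda>w. vec_index w i"] that v(1) A
      by (simp add: scalar_prod_def atLeast0LessThan)
    \<comment> \<open>At an eigenvector the form is the eigenvalue times the squared norm; dividing
      by this positive number leaves the eigenvalue.\<close>
    have q: "(\<Sum>i<n. \<Sum>j<n. cnj (vec_index v i) * A $$ (i, j) * vec_index v j) =
        e * of_real (\<Sum>i<n. (norm (vec_index v i))\<^sup>2)"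
      by (simp add: mult.assoc row flip: sum_distrib_left)
         (simp add: sum_distrib_left complex_norm_square ac_simps flip: of_real_power)
    obtain i where "i < n" "vec_index v i \<noteq> 0"
      using v(1,2) by (metis carrier_vecD eq_vecI index_zero_vec(1,2))
    then have pos: "(\<Sum>i<n. (norm (vec_index v i))\<^sup>2) > 0"
      by (intro sum_pos2[where i = i]) auto
    have "(e * of_real (\<Sum>i<n. (norm (vec_index v i))\<^sup>2)) / of_real (\<Sum>i<n. (norm (vec_index v i))\<^sup>2) \<in> \<real>\<^sub>\<ge>\<^sub>0"
      using psd[of "vec_index v"] pos unfolding q
      by (intro nonneg_Reals_divide_I) (auto simp del: of_real_sum)
    with pos show ?thesis by (simp del: of_real_sum)
  qed
  have "Determinant.det A = prod_list es"
  proof -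
    \<comment> \<open>Evaluation at 0 is a ring homomorphism, so it commutes with the determinant
      and sends the characteristic matrix to -A; the sign then cancels against that of the product
      of the \<open>- a\<close>.\<close>
    have "poly (char_poly A) 0 = Determinant.det (map_mat (\<lambda>p. poly p 0) (char_poly_matrix A))"
      unfolding char_poly_def by (rule comm_ring_hom.hom_det[symmetric]) (unfold_locales, auto)
    also have "map_mat (\<lambda>p. poly p 0) (char_poly_matrix A) = (- 1) \<cdot>\<^sub>m A"
      using A by (intro eq_matI) (auto simp: char_poly_matrix_def)
    also have "Determinant.det \<dots> = (- 1) ^ n * Determinant.det A" using A by simp
    finally have "(- 1) ^ n * Determinant.det A = (\<Prod>a\<leftarrow>es. - a)"
      by (simp add: es(1) poly_prod_list o_def)
    also have "\<dots> = (- 1) ^ length es * prod_list es" by (induction es) auto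
    finally show ?thesis using es(2) by simp
  qed
  also have "prod_list es \<in> \<real>\<^sub>\<ge>\<^sub>0"
    using ev by (induction es) auto
  finally show ?thesis .
qed

section \<open>Integrals against complex measures and iterated integrals\<close>

lemma
  shows cm_integrable_sum:
    "\<lbrakk>\<And>s. s \<in> S \<Longrightarrow> cm_integrable M \<nu> (f s)\<rbrakk> \<Longrightarrow> cm_integrable M \<nu> (\<lambda>x. \<Sum>s\<in>S. f s x)"
  and cm_integrable_mult_right:
    "cm_integrable M \<nu> g \<Longrightarrow> cm_integrable M \<nu> (\<lambda>x. a * g x)"
  by (auto simp: cm_integrable_def)

lemma cm_integral_sum:
  assumes "\<And>s. s \<in> S \<Longrightarrow> cm_integrable M \<nu> (f s)"
  shows "cm_integral M \<nu> (\<lambda>x. \<Sum>s\<in>S. a s * f s x) = (\<Sum>s\<in>S. a s * cm_integral M \<nu> (f s))"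
proof -
  have "(\<integral>x. (\<Sum>s\<in>S. a s * f s x) \<partial>N) = (\<Sum>s\<in>S. a s * (\<integral>x. f s x \<partial>N))"
    if "\<And>s. s \<in> S \<Longrightarrow> integrable N (f s)" for N
    using that by (subst Bochner_Integration.integral_sum) auto
  then show ?thesis using assms unfolding cm_integral_def cm_integrable_def
    by (simp add: sum.distrib sum_subtractf sum_distrib_left algebra_simps)
qed

lemma cm_integral_cong:
  assumes "\<And>x. x \<in> space M \<Longrightarrow> f x = g x"
  shows "cm_integral M \<nu> f = cm_integral M \<nu> g"
  unfolding cm_integral_def
  by (intro arg_cong2[where f = "(+)"] arg_cong2[where f = "(-)"] arg_cong2[where f = "(*)"]
      Bochner_Integration.integral_cong refl) (simp_all add: assms)

lemma cm_integrable_cong: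
  assumes "\<And>x. x \<in> space M \<Longrightarrow> f x = g x"
  shows "cm_integrable M \<nu> f \<longleftrightarrow> cm_integrable M \<nu> g"
  unfolding cm_integrable_def
  by (intro arg_cong2[where f = "(\<and>)"] Bochner_Integration.integrable_cong refl) (simp_all add: assms)

text \<open>The four positive measures behind a complex measure are finite, so bounded measurable
  functions are integrable against each of them.\<close>

lemma cm_integrable_bounded:
  assumes "complex_measure M \<nu>" "f \<in> borel_measurable M" "\<And>x. x \<in> space M \<Longrightarrow> norm (f x) \<le> B"
  shows "cm_integrable M \<nu> f"
proof -
  \<comment> \<open>\<open>h\<close> stands for the real part, the imaginary part and their
    negatives.\<close>
  have *: "integrable (pos_part_measure M (\<lambda>E. h (\<nu> E))) f" if "bounded_linear h" for h :: "complex \<Rightarrow> real"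
  proof -
    interpret finite_measure "pos_part_measure M (\<lambda>E. h (\<nu> E))"
      by (intro finite_measure_pos_part_measure vector_measure_linear[OF assms(1) that])
    have "f \<in> borel_measurable (pos_part_measure M (\<lambda>E. h (\<nu> E)))"
      using assms(2) by simp
    with assms(3) show ?thesis by (intro integrable_const_bound[of _ B] AE_I2) auto
  qed
  show ?thesis unfolding cm_integrable_def
    by (intro conjI *) (auto intro!: bounded_linear_minus bounded_linear_Re bounded_linear_Im)
qed

text \<open>A finite sum of products of functions of one variable can be integrated one variable at
  a time by linearity, without Fubini.\<close>

lemma iterated_integral_sum_prod:
  assumes "\<And>s j. s \<in> S \<Longrightarrow> j \<in> {1..m} \<Longrightarrow> cm_integrable M (\<nu> j) (f s j)"
  shows "iterated_integral M \<nu> m (\<lambda>z. \<Sum>s\<in>S. a s * (\<Prod>j=1..m. f s j (z j))) =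
    (\<Sum>s\<in>S. a s * (\<Prod>j=1..m. cm_integral M (\<nu> j) (f s j)))"
  using assms
\<comment> \<open>\<open>a\<close> must vary: the factor in the outermost variable is constant for
  the inner integrals and is absorbed into the coefficients.\<close>
proof (induction m arbitrary: a)
  case (Suc m)
  have "(\<Prod>j=1..Suc m. f s j ((z(Suc m := x)) j)) = f s (Suc m) x * (\<Prod>j=1..m. f s j (z j))" for s x z
  proof -
    have "(\<Prod>j=1..m. f s j ((z(Suc m := x)) j)) = (\<Prod>j=1..m. f s j (z j))"
      by (intro prod.cong) auto
    then show ?thesis by (simp add: mult.commute)
  qed
  then have "iterated_integral M \<nu> (Suc m) (\<lambda>z. \<Sum>s\<in>S. a s * (\<Prod>j=1..Suc m. f s j (z j))) =
    cm_integral M (\<nu> (Suc m)) (\<lambda>x. iterated_integral M \<nu> m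
      (\<lambda>z. \<Sum>s\<in>S. (a s * f s (Suc m) x) * (\<Prod>j=1..m. f s j (z j))))"
    by (simp only: iterated_integral.simps mult.assoc)
  also have "\<dots> = cm_integral M (\<nu> (Suc m)) (\<lambda>x. \<Sum>s\<in>S. (a s * (\<Prod>j=1..m. cm_integral M (\<nu> j) (f s j))) * f s (Suc m) x)"
    using Suc.prems by (subst Suc.IH) (auto simp: mult_ac)
  also have "\<dots> = (\<Sum>s\<in>S. a s * (\<Prod>j=1..Suc m. cm_integral M (\<nu> j) (f s j)))"
    using Suc.prems by (subst cm_integral_sum) (auto simp: mult_ac)
  finally show ?case .
qed simp

text \<open>Column j involves only the variable \<open>z (j + 1)\<close>, so by the Leibniz formula
  each integral moves into its own column. The weight \<open>w\<close> is 1 on the line and a power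
  of the variable on the circle.\<close>

lemma iterated_integral_det:
  assumes "\<And>i j. i < m \<Longrightarrow> j < m \<Longrightarrow> cm_integrable M (\<nu> (j + 1)) (\<lambda>x. F i x * w x)"
  shows "iterated_integral M \<nu> m (\<lambda>z.
      Determinant.det (Matrix.mat m m (\<lambda>(i, j). F i (z (j + 1)))) * (\<Prod>j=1..m. w (z j))) =
    Determinant.det (Matrix.mat m m (\<lambda>(i, j). cm_integral M (\<nu> (j + 1)) (\<lambda>x. F i x * w x)))"
proof -
  let ?S = "{p. p permutes {0..<m}}"
  \<comment> \<open>Columns are counted from 0, variables from 1.\<close>
  have shift: "(\<Prod>j<m. h j) = (\<Prod>j=1..m. h (j - 1))" for h :: "nat \<Rightarrow> complex"
    by (rule prod.reindex_bij_witness[of _ "\<lambda>j. j - 1" Suc]) auto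
  \<comment> \<open>In this form of the Leibniz formula the permutation acts on the row index, so
    each factor belongs to one variable.\<close>
  have det: "Determinant.det (Matrix.mat m m (\<lambda>(i, j). G i j)) =
      (\<Sum>p\<in>?S. signof p * (\<Prod>j=1..m. G (p (j - 1)) (j - 1)))" for G :: "nat \<Rightarrow> nat \<Rightarrow> complex"
  proof -
    have "Determinant.det (Matrix.mat m m (\<lambda>(i, j). G i j)) =
      (\<Sum>p\<in>?S. signof p * (\<Prod>j<m. Matrix.mat m m (\<lambda>(i, j). G i j) $$ (p j, j)))"
      by (rule det_col) simp
    also have "\<dots> = (\<Sum>p\<in>?S. signof p * (\<Prod>j<m. G (p j) j))"
      by (intro sum.cong refl arg_cong2[of _ _ _ _ "(*)"] prod.cong)
         (auto dest: permutes_in_image)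
    finally show ?thesis by (simp only: shift)
  qed
  have "Determinant.det (Matrix.mat m m (\<lambda>(i, j). F i (z (j + 1)))) * (\<Prod>j=1..m. w (z j)) =
     (\<Sum>p\<in>?S. signof p * (\<Prod>j=1..m. F (p (j - 1)) (z j) * w (z j)))" for z
    unfolding det by (simp add: sum_distrib_right mult.assoc flip: prod.distrib)
  moreover have "iterated_integral M \<nu> m (\<lambda>z. \<Sum>p\<in>?S. signof p * (\<Prod>j=1..m. F (p (j - 1)) (z j) * w (z j))) =
     (\<Sum>p\<in>?S. signof p * (\<Prod>j=1..m. cm_integral M (\<nu> j) (\<lambda>x. F (p (j - 1)) x * w x)))"
  proof (rule iterated_integral_sum_prod)
    fix p j assume "p \<in> ?S" "j \<in> {1..m}"
    then have "p (j - 1) < m" "j - 1 < m" using permutes_in_image[of p "{0..<m}" "j - 1"] by auto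
    with assms[of "p (j - 1)" "j - 1"] \<open>j \<in> {1..m}\<close>
    show "cm_integrable M (\<nu> j) (\<lambda>x. F (p (j - 1)) x * w x)" by simp
  qed
  ultimately show ?thesis unfolding det by simp
qed

section \<open>Monic orthogonal polynomials on the line\<close>

text \<open>Existence comes from the Hankel matrix bordered by powers of x, divided by
  \<open>hankel_det \<mu> k\<close>; uniqueness from the trivial kernel of the Hankel matrix.
  Orthogonality is phrased by moments, which makes the argument pure linear algebra.\<close>

lemma orth_poly_ex1:
  fixes \<mu> :: "real measure"
  assumes H: "hankel_det \<mu> k \<noteq> 0"
  shows "\<exists>!P. degree P = k \<and> lead_coeff P = 1 \<and> (\<forall>j<k. (\<Sum>i\<le>k. coeff P i * (\<integral>x. x ^ (i + j) \<partial>\<mu>)) = 0)"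
proof (rule ex_ex1I)
  define a where "a i j = (\<integral>x. x ^ (i + j) \<partial>\<mu>)" for i j
  have det: "hankel_det \<mu> k = Determinant.det (Matrix.mat k k (\<lambda>(i, j). a i j))"
    by (simp add: hankel_det_def a_def)
  define P where "P = (\<Sum>j\<le>k. Polynomial.monom (border_coeff k a j / hankel_det \<mu> k) j)"
  have coeff: "coeff P i = (if i \<le> k then border_coeff k a i / hankel_det \<mu> k else 0)" for i
    by (simp add: P_def coeff_sum)
  have lead: "coeff P k = 1" using H by (simp add: coeff border_coeff_lead det)
  have deg: "degree P = k"
    using lead by (intro antisym degree_le le_degree) (auto simp: coeff)
  have "(\<Sum>i\<le>k. coeff P i * (\<integral>x. x ^ (i + j) \<partial>\<mu>)) = (\<Sum>i\<le>k. border_coeff k a i * a j i) / hankel_det \<mu> k" for j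
    by (simp add: coeff a_def add.commute sum_divide_distrib)
  then show "\<exists>P. degree P = k \<and> lead_coeff P = 1 \<and> (\<forall>j<k. (\<Sum>i\<le>k. coeff P i * (\<integral>x. x ^ (i + j) \<partial>\<mu>)) = 0)"
    using deg lead by (intro exI[of _ P]) (simp add: border_coeff_orth)
next
  fix P Q :: "real poly"
  assume P: "degree P = k \<and> lead_coeff P = 1 \<and> (\<forall>j<k. (\<Sum>i\<le>k. coeff P i * (\<integral>x. x ^ (i + j) \<partial>\<mu>)) = 0)"
    and Q: "degree Q = k \<and> lead_coeff Q = 1 \<and> (\<forall>j<k. (\<Sum>i\<le>k. coeff Q i * (\<integral>x. x ^ (i + j) \<partial>\<mu>)) = 0)"
  \<comment> \<open>Both polynomials are monic of degree k, so k coefficients determine their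
    difference.\<close>
  define v where "v = Matrix.vec k (\<lambda>i. coeff (P - Q) i)"
  let ?A = "Matrix.mat k k (\<lambda>(i, j). \<integral>x. x ^ (i + j) \<partial>\<mu>)"
  have "?A *\<^sub>v v = 0\<^sub>v k"
  proof (rule eq_vecI)
    fix j assume "j < dim_vec (0\<^sub>v k :: real Matrix.vec)"
    then have j: "j < k" by simp
    have "(\<Sum>i\<le>k. coeff (P - Q) i * (\<integral>x. x ^ (i + j) \<partial>\<mu>)) = 0"
      using P Q j by (simp add: left_diff_distrib sum_subtractf)
    moreover have "coeff (P - Q) k = 0" using P Q by auto
    ultimately have "(\<Sum>i<k. coeff (P - Q) i * (\<integral>x. x ^ (i + j) \<partial>\<mu>)) = 0"
      by (simp add: lessThan_Suc_atMost[symmetric] del: coeff_diff)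
    then show "vec_index (?A *\<^sub>v v) j = vec_index (0\<^sub>v k) j"
      using j by (simp add: v_def scalar_prod_def atLeast0LessThan ac_simps del: coeff_diff)
  qed simp
  then have "v = 0\<^sub>v k"
    using H det_0_iff_vec_prod_zero_field[of ?A k] unfolding hankel_det_def
    by (metis mat_carrier v_def vec_carrier)
  then have small: "coeff (P - Q) i = 0" if "i < k" for i
    using that by (metis index_vec index_zero_vec(1) v_def)
  show "P = Q"
  proof (rule poly_eqI)
    fix i
    consider "i < k" | "i = k" | "i > k" by linarith
    then show "coeff P i = coeff Q i"
      by cases (use P Q small in \<open>auto simp: coeff_eq_0\<close>)
  qed
qed

text \<open>Finite moments turn the integrals in \<open>orth_poly\<close> into sums of moments, so
  \<open>orth_poly_ex1\<close> justifies the definite description.\<close>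

lemma
  fixes \<mu> :: "real measure"
  assumes int: "\<And>k::nat. integrable \<mu> (\<lambda>x. x ^ k)" and H: "hankel_det \<mu> k \<noteq> 0"
  shows degree_orth_poly: "degree (orth_poly \<mu> k) = k"
    and lead_coeff_orth_poly: "coeff (orth_poly \<mu> k) k = 1"
    and orth_poly_moments:
      "j < k \<Longrightarrow> (\<Sum>i\<le>k. coeff (orth_poly \<mu> k) i * (\<integral>x. x ^ (i + j) \<partial>\<mu>)) = 0"
proof -
  have "(\<integral>x. poly P x * x ^ j \<partial>\<mu>) = (\<Sum>i\<le>degree P. coeff P i * (\<integral>x. x ^ (i + j) \<partial>\<mu>))" for P j
    by (simp add: poly_altdef sum_distrib_right mult.assoc int flip: power_add)
  then have eq: "orth_poly \<mu> k = (THE P. degree P = k \<and> lead_coeff P = 1 \<and>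
      (\<forall>j<k. (\<Sum>i\<le>k. coeff P i * (\<integral>x. x ^ (i + j) \<partial>\<mu>)) = 0))"
    \<comment> \<open>The congruence rule makes \<open>degree P = k\<close> available when the upper
      summation bound is rewritten.\<close>
    unfolding orth_poly_def by (intro arg_cong[where f = The] ext) (simp cong: conj_cong)
  have "degree (orth_poly \<mu> k) = k \<and> lead_coeff (orth_poly \<mu> k) = 1 \<and>
      (\<forall>j<k. (\<Sum>i\<le>k. coeff (orth_poly \<mu> k) i * (\<integral>x. x ^ (i + j) \<partial>\<mu>)) = 0)"
    unfolding eq by (rule theI'[OF orth_poly_ex1[OF H]])
  then show "degree (orth_poly \<mu> k) = k" "coeff (orth_poly \<mu> k) k = 1"
    "j < k \<Longrightarrow> (\<Sum>i\<le>k. coeff (orth_poly \<mu> k) i * (\<integral>x. x ^ (i + j) \<partial>\<mu>)) = 0"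
    by auto
qed

section \<open>Bordered Hankel determinants\<close>

lemma bordered_hankel_det_eq_iterated_integral:
  fixes \<mu> :: "real measure" and \<nu> :: "nat \<Rightarrow> real set \<Rightarrow> complex"
  assumes m: "m < n"
    and int: "\<And>k::nat. integrable \<mu> (\<lambda>x. x ^ k)"
    and H: "\<And>k. k \<in> {n - m..n - 1} \<Longrightarrow> hankel_det \<mu> k \<noteq> 0"
    and \<nu>: "\<And>j (k::nat). j \<in> {1..m} \<Longrightarrow> cm_integrable borel (\<nu> j) (\<lambda>x. complex_of_real x ^ k)"
  shows "bordered_hankel_det \<mu> \<nu> m n =
    complex_of_real (hankel_det \<mu> (n - m)) *
    iterated_integral borel \<nu> m (\<lambda>z.
      Determinant.det (Matrix.mat m m (\<lambda>(i, j).
        complex_of_real (poly (orth_poly \<mu> (n - m + i)) (z (j + 1))))))"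
proof -
  define d where "d = n - m"
  have d: "d \<le> n" "n - d = m" "0 < n" using m by (auto simp: d_def)
  define c where "c k l = complex_of_real (coeff (orth_poly \<mu> k) l)" for k l
  define A where "A = Matrix.mat n n (\<lambda>(i, j).
       if j < n - m then complex_of_real (\<integral>x. x ^ (i + j) \<partial>\<mu>)
       else cm_integral borel (\<nu> (j - (n - m) + 1)) (\<lambda>x. complex_of_real x ^ i))"
  have Hk: "hankel_det \<mu> k \<noteq> 0" if "d \<le> k" "k < n" for k
    using that by (intro H) (auto simp: d_def)
  have ann: "(\<Sum>l\<le>k. c k l * A $$ (l, j)) = 0" if "d \<le> k" "k < n" "j < d" for k j
  proof -
    have "(\<Sum>l\<le>k. c k l * A $$ (l, j)) =
        of_real (\<Sum>l\<le>k. coeff (orth_poly \<mu> k) l * (\<integral>x. x ^ (l + j) \<partial>\<mu>))"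
      using that d by (simp add: A_def c_def flip: d_def)
    also have "\<dots> = 0" using that by (simp only: orth_poly_moments[OF int Hk] of_real_0)
    finally show ?thesis .
  qed
  \<comment> \<open>By linearity the moments of the border measure combine to the integral of the
    orthogonal polynomial.\<close>
  have corner: "(\<Sum>l\<le>d + i. c (d + i) l * A $$ (l, d + j)) =
      cm_integral borel (\<nu> (j + 1)) (\<lambda>x. of_real (poly (orth_poly \<mu> (d + i)) x))"
    if "i < m" "j < m" for i j
  proof -
    have "(\<Sum>l\<le>d + i. c (d + i) l * A $$ (l, d + j)) =
        (\<Sum>l\<le>d + i. c (d + i) l * cm_integral borel (\<nu> (j + 1)) (\<lambda>x. complex_of_real x ^ l))"
      using that m by (intro sum.cong) (auto simp: A_def d_def)
    also have "\<dots> = cm_integral borel (\<nu> (j + 1)) (\<lambda>x. \<Sum>l\<le>d + i. c (d + i) l * of_real x ^ l)"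
      using that by (intro cm_integral_sum[symmetric] \<nu>) auto
    also have "(\<lambda>x. \<Sum>l\<le>d + i. c (d + i) l * of_real x ^ l) = (\<lambda>x. of_real (poly (orth_poly \<mu> (d + i)) x))"
      using that m by (simp add: poly_altdef c_def degree_orth_poly[OF int Hk] d_def)
    finally show ?thesis .
  qed
  \<comment> \<open>The factor 1 is the weight \<open>w\<close> of
    \<open>iterated_integral_det\<close>.\<close>
  have integrable: "cm_integrable borel (\<nu> (j + 1)) (\<lambda>x. of_real (poly (orth_poly \<mu> (d + i)) x) * 1)"
    if "j < m" for i j
    unfolding poly_altdef using that
    by (simp, intro cm_integrable_sum cm_integrable_mult_right \<nu>) auto
  \<comment> \<open>The polynomials are monic, so the inserted product is 1.\<close>
  have "bordered_hankel_det \<mu> \<nu> m n = (\<Prod>k=d..<n. c k k) * Determinant.det A"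
    by (simp add: c_def A_def bordered_hankel_det_def lead_coeff_orth_poly[OF int Hk])
  also have "\<dots> = Determinant.det (Matrix.mat d d (\<lambda>(i, j). A $$ (i, j))) *
    Determinant.det (Matrix.mat m m (\<lambda>(i, j). \<Sum>l\<le>d + i. c (d + i) l * A $$ (l, d + j)))"
    using det_mult_block_reduce[of A n d c] d ann by (simp add: A_def)
  also have "Matrix.mat d d (\<lambda>(i, j). A $$ (i, j)) =
      map_mat complex_of_real (Matrix.mat d d (\<lambda>(i, j). \<integral>x. x ^ (i + j) \<partial>\<mu>))"
    using d by (intro eq_matI) (auto simp: A_def simp flip: d_def)
  also have "Matrix.mat m m (\<lambda>(i, j). \<Sum>l\<le>d + i. c (d + i) l * A $$ (l, d + j)) =
      Matrix.mat m m (\<lambda>(i, j). cm_integral borel (\<nu> (j + 1)) (\<lambda>x. of_real (poly (orth_poly \<mu> (d + i)) x) * 1))"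
    by (intro eq_matI) (simp_all add: corner)
  also have "Determinant.det \<dots> = iterated_integral borel \<nu> m (\<lambda>z.
      Determinant.det (Matrix.mat m m (\<lambda>(i, j).
        complex_of_real (poly (orth_poly \<mu> (d + i)) (z (j + 1))))) * (\<Prod>j=1..m. 1))"
    by (rule iterated_integral_det[symmetric]) (rule integrable)
  finally show ?thesis by (simp add: of_real_hom.hom_det hankel_det_def flip: d_def)
qed

section \<open>Toeplitz determinants of measures on the circle\<close>

lemma borel_measurable_powi_circle:
  assumes "sets \<phi> = sets circle_borel"
  shows "(\<lambda>\<zeta>. \<zeta> powi k) \<in> borel_measurable \<phi>"
proof -
  have "(\<lambda>\<zeta>::complex. \<zeta> powi k) \<in> borel_measurable circle_borel"
    by (intro borel_measurable_continuous_on_restrict continuous_intros) auto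
  with assms show ?thesis by (simp cong: measurable_cong_sets)
qed

text \<open>The quadratic form of the Toeplitz matrix at v is the integral of the squared modulus of
  the polynomial with coefficients v.\<close>

lemma toeplitz_det_nonneg:
  assumes sets: "sets \<phi> = sets circle_borel" and fin: "finite_measure \<phi>"
  shows "toeplitz_det \<phi> k \<in> \<real>\<^sub>\<ge>\<^sub>0"
proof -
  interpret finite_measure \<phi> by fact
  have space: "norm \<zeta> = 1" if "\<zeta> \<in> space \<phi>" for \<zeta>
    using that sets_eq_imp_space_eq[OF sets] by (simp add: space_restrict_space)
  have int: "integrable \<phi> (\<lambda>\<zeta>. \<zeta> powi j)" for j
    by (rule integrable_const_bound[of _ 1])
       (auto intro!: AE_I2 borel_measurable_powi_circle[OF sets] simp: norm_power_int space)
  show ?thesis unfolding toeplitz_det_def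
  proof (rule det_in_nonneg_Reals)
    fix v :: "nat \<Rightarrow> complex"
    have "(\<Sum>i<k. \<Sum>j<k. cnj (v i) * Matrix.mat k k (\<lambda>(i, j). circle_moment \<phi> (int i - int j)) $$ (i, j) * v j) =
        (\<Sum>i<k. \<Sum>j<k. (\<integral>\<zeta>. cnj (v i) * v j * \<zeta> powi (int j - int i) \<partial>\<phi>))"
      by (intro sum.cong) (auto simp: circle_moment_def ac_simps)
    also have "\<dots> = (\<integral>\<zeta>. (\<Sum>i<k. \<Sum>j<k. cnj (v i) * v j * \<zeta> powi (int j - int i)) \<partial>\<phi>)"
      by (simp add: int)
    also have "\<dots> = (\<integral>\<zeta>. of_real ((norm (\<Sum>j<k. v j * \<zeta> ^ j))\<^sup>2) \<partial>\<phi>)"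
    proof (intro Bochner_Integration.integral_cong refl)
      fix \<zeta> assume "\<zeta> \<in> space \<phi>"
      then have "norm \<zeta> = 1" by (rule space)
      \<comment> \<open>On the circle conjugation is inversion, so the power with exponent j - i
        splits into a power and a conjugated power.\<close>
      then have \<zeta>: "\<zeta> \<noteq> 0" "cnj \<zeta> = inverse \<zeta>"
        using complex_norm_square[of \<zeta>] by (auto intro: inverse_unique[symmetric])
      have "cnj (v i) * v j * \<zeta> powi (int j - int i) = (v j * \<zeta> ^ j) * cnj (v i * \<zeta> ^ i)" for i j
        unfolding complex_cnj_mult complex_cnj_power \<zeta>(2)
        using \<zeta>(1) by (simp add: power_int_diff field_simps)
      then show "(\<Sum>i<k. \<Sum>j<k. cnj (v i) * v j * \<zeta> powi (int j - int i)) =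
          of_real ((norm (\<Sum>j<k. v j * \<zeta> ^ j))\<^sup>2)"
        unfolding complex_norm_square cnj_sum sum_product
        by (subst sum.swap) (simp only:)
    qed
    also have "\<dots> = of_real (\<integral>\<zeta>. (norm (\<Sum>j<k. v j * \<zeta> ^ j))\<^sup>2 \<partial>\<phi>)"
      by (rule integral_complex_of_real)
    also have "\<dots> \<in> \<real>\<^sub>\<ge>\<^sub>0" by simp
    finally show "(\<Sum>i<k. \<Sum>j<k. cnj (v i) * Matrix.mat k k (\<lambda>(i, j). circle_moment \<phi> (int i - int j)) $$ (i, j) * v j) \<in> \<real>\<^sub>\<ge>\<^sub>0" .
  qed simp
qed

text \<open>Each factor is the square root of \<open>r k / r (k + 1)\<close>, so the product is that
  of \<open>r d / r n\<close>.\<close>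

lemma prod_div_sqrt_telescope:
  fixes r :: "nat \<Rightarrow> real"
  assumes "d \<le> n" "\<And>k. k \<in> {d..n} \<Longrightarrow> r k > 0"
  shows "(\<Prod>k=d..<n. r k / sqrt (r k * r (k + 1))) * sqrt (r d * r n) = r d"
  using assms
proof (induction n rule: dec_induct)
  case (step n)
  have pos: "r d > 0" "r n > 0" "r (Suc n) > 0" using step by auto
  have "(\<Prod>k=d..<Suc n. r k / sqrt (r k * r (k + 1))) * sqrt (r d * r (Suc n)) =
    (\<Prod>k=d..<n. r k / sqrt (r k * r (k + 1))) * (r n / sqrt (r n * r (Suc n)) * sqrt (r d * r (Suc n)))"
    using step.hyps by simp
  also have "r n / sqrt (r n * r (Suc n)) * sqrt (r d * r (Suc n)) = sqrt (r d * r n)"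
    using pos by (simp add: real_sqrt_mult field_simps)
  finally show ?case using step by simp
qed simp

text \<open>The rows are combined with the coefficients of \<open>circle_poly\<close>, which are not
  monic. Nonvanishing is assumed up to index n because the polynomial of degree n - 1 is normalised
  by \<open>toeplitz_det \<phi> n\<close>.\<close>

lemma bordered_toeplitz_det_eq_iterated_integral:
  assumes m: "m < n"
    and sets: "sets \<phi> = sets circle_borel" and fin: "finite_measure \<phi>"
    and D: "\<And>k. k \<in> {n - m..n} \<Longrightarrow> toeplitz_det \<phi> k \<noteq> 0"
    and \<psi>: "\<And>j. j \<in> {1..m} \<Longrightarrow> complex_measure circle_borel (\<psi> j)"
  shows "bordered_toeplitz_det \<phi> \<psi> m n =
    csqrt (toeplitz_det \<phi> (n - m) * toeplitz_det \<phi> n) *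
    iterated_integral circle_borel \<psi> m (\<lambda>z.
      Determinant.det (Matrix.mat m m (\<lambda>(i, j). circle_poly \<phi> (n - m + i) (z (j + 1)))) *
      (\<Prod>j=1..m. z j powi (- int n + 1)))"
proof -
  define d where "d = n - m"
  have d: "d \<le> n" "n - d = m" "0 < n" using m by (auto simp: d_def)
  define r where "r k = Re (toeplitz_det \<phi> k)" for k
  have r: "toeplitz_det \<phi> k = of_real (r k)" "0 \<le> r k" for k
    using toeplitz_det_nonneg[OF sets fin, of k] by (auto simp: r_def nonneg_Reals_def)
  have rpos: "0 < r k" if "k \<in> {d..n}" for k
    using D[of k] that r(2)[of k] by (auto simp: r(1) d_def)
  define s where "s k = sqrt (r k * r (k + 1))" for k
  \<comment> \<open>This is the index order of \<open>circle_poly\<close>, transposed to that of the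
    bordered determinant: in the first d columns, column j of \<open>A\<close> is row j of
    \<open>a\<close>.\<close>
  define a where "a i j = circle_moment \<phi> (int i - int j)" for i j
  define c where "c k l = border_coeff k a l / of_real (s k)" for k l
  \<comment> \<open>On nonnegative reals the principal complex root is the real root.\<close>
  have csqrt: "csqrt (toeplitz_det \<phi> i * toeplitz_det \<phi> j) = of_real (sqrt (r i * r j))" for i j
    using r(2) by (simp add: r(1) flip: of_real_mult of_real_sqrt)
  have poly: "circle_poly \<phi> k z = (\<Sum>l\<le>k. c k l * z ^ l)" for k z
    unfolding circle_poly_def csqrt s_def[symmetric] c_def a_def[symmetric]
    by (simp add: det_border_row[unfolded Suc_eq_plus1[symmetric]] sum_divide_distrib)
  have lead: "c k k = of_real (r k / s k)" for k
    by (simp add: c_def border_coeff_lead a_def toeplitz_det_def flip: r(1))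
  define A where "A = Matrix.mat n n (\<lambda>(i, j).
       if j < n - m then circle_moment \<phi> (int j - int i)
       else cm_integral circle_borel (\<psi> (j - (n - m) + 1)) (\<lambda>\<zeta>. \<zeta> powi (- (int n - 1 - int i))))"
  have ann: "(\<Sum>l\<le>k. c k l * A $$ (l, j)) = 0" if "d \<le> k" "k < n" "j < d" for k j
  proof -
    have "(\<Sum>l\<le>k. c k l * A $$ (l, j)) = (\<Sum>l\<le>k. border_coeff k a l * a j l) / of_real (s k)"
      using that d by (simp add: A_def a_def c_def sum_divide_distrib flip: d_def)
    also have "\<dots> = 0" using that by (simp add: border_coeff_orth)
    finally show ?thesis .
  qed
  have powi: "cm_integrable circle_borel (\<psi> (j + 1)) (\<lambda>\<zeta>. \<zeta> powi e)" if "j < m" for j e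
    using that
    by (intro cm_integrable_bounded[where B = 1] \<psi> borel_measurable_powi_circle)
       (auto simp: norm_power_int space_restrict_space)
  \<comment> \<open>The weight shifts the monomial of degree l to the exponent in row l of the
    border columns. Adding exponents uses that \<zeta> is nonzero, hence the restriction to the
    circle.\<close>
  have expand: "circle_poly \<phi> k \<zeta> * \<zeta> powi (- int n + 1) =
      (\<Sum>l\<le>k. c k l * \<zeta> powi (- (int n - 1 - int l)))" if "\<zeta> \<in> space circle_borel" for k \<zeta>
  proof -
    have "\<zeta> \<noteq> 0" using that by (auto simp: space_restrict_space)
    then have "\<zeta> ^ l * \<zeta> powi (- int n + 1) = \<zeta> powi (- (int n - 1 - int l))" for l
      by (simp add: algebra_simps flip: power_int_of_nat power_int_add)
    then show ?thesis by (simp add: poly sum_distrib_right mult.assoc)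
  qed
  have corner: "(\<Sum>l\<le>d + i. c (d + i) l * A $$ (l, d + j)) =
      cm_integral circle_borel (\<psi> (j + 1)) (\<lambda>\<zeta>. circle_poly \<phi> (d + i) \<zeta> * \<zeta> powi (- int n + 1))"
    if "i < m" "j < m" for i j
  proof -
    have "(\<Sum>l\<le>d + i. c (d + i) l * A $$ (l, d + j)) =
        (\<Sum>l\<le>d + i. c (d + i) l * cm_integral circle_borel (\<psi> (j + 1)) (\<lambda>\<zeta>. \<zeta> powi (- (int n - 1 - int l))))"
      using that m by (intro sum.cong) (auto simp: A_def d_def)
    also have "\<dots> = cm_integral circle_borel (\<psi> (j + 1))
        (\<lambda>\<zeta>. \<Sum>l\<le>d + i. c (d + i) l * \<zeta> powi (- (int n - 1 - int l)))"
      using that by (intro cm_integral_sum[symmetric] powi)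
    also have "\<dots> = cm_integral circle_borel (\<psi> (j + 1)) (\<lambda>\<zeta>. circle_poly \<phi> (d + i) \<zeta> * \<zeta> powi (- int n + 1))"
      by (rule cm_integral_cong) (simp only: expand)
    finally show ?thesis .
  qed
  have integrable: "cm_integrable circle_borel (\<psi> (j + 1)) (\<lambda>\<zeta>. circle_poly \<phi> (d + i) \<zeta> * \<zeta> powi (- int n + 1))"
    if "j < m" for i j
    by (rule iffD2[OF cm_integrable_cong[OF expand]], assumption)
       (intro cm_integrable_sum cm_integrable_mult_right powi that)
  let ?I = "iterated_integral circle_borel \<psi> m (\<lambda>z.
      Determinant.det (Matrix.mat m m (\<lambda>(i, j). circle_poly \<phi> (d + i) (z (j + 1)))) *
      (\<Prod>j=1..m. z j powi (- int n + 1)))"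
  have "(\<Prod>k=d..<n. c k k) * Determinant.det A = Determinant.det (Matrix.mat d d (\<lambda>(i, j). A $$ (i, j))) *
    Determinant.det (Matrix.mat m m (\<lambda>(i, j). \<Sum>l\<le>d + i. c (d + i) l * A $$ (l, d + j)))"
    using det_mult_block_reduce[of A n d c] d ann by (simp add: A_def)
  also have "Matrix.mat d d (\<lambda>(i, j). A $$ (i, j)) =
      transpose_mat (Matrix.mat d d (\<lambda>(i, j). a i j))"
    using d by (intro eq_matI) (auto simp: A_def a_def simp flip: d_def)
  also have "Determinant.det \<dots> = toeplitz_det \<phi> d"
    unfolding toeplitz_det_def a_def[abs_def] by (rule det_transpose[where n = d]) simp
  also have "Matrix.mat m m (\<lambda>(i, j). \<Sum>l\<le>d + i. c (d + i) l * A $$ (l, d + j)) =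
      Matrix.mat m m (\<lambda>(i, j). cm_integral circle_borel (\<psi> (j + 1)) (\<lambda>\<zeta>. circle_poly \<phi> (d + i) \<zeta> * \<zeta> powi (- int n + 1)))"
    by (intro eq_matI) (simp_all add: corner)
  also have "Determinant.det \<dots> = ?I"
    by (rule iterated_integral_det[symmetric]) (rule integrable)
  \<comment> \<open>Telescoping exhibits the product of the \<open>c k k\<close> as a factor on the
    right; being nonzero, it cancels.\<close>
  also have "toeplitz_det \<phi> d = (\<Prod>k=d..<n. c k k) * of_real (sqrt (r d * r n))"
    unfolding lead s_def r(1) using prod_div_sqrt_telescope[of d n r] d rpos
    by (simp only: flip: of_real_prod of_real_mult)
  finally have "(\<Prod>k=d..<n. c k k) * Determinant.det A =
      (\<Prod>k=d..<n. c k k) * (of_real (sqrt (r d * r n)) * ?I)"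
    by (simp only: mult.assoc)
  moreover have "(\<Prod>k=d..<n. c k k) \<noteq> 0"
  proof -
    have "r k \<noteq> 0" "s k \<noteq> 0" if "k \<in> {d..<n}" for k
      using that rpos[of k] rpos[of "k + 1"] by (auto simp: s_def)
    then show ?thesis by (auto simp: lead)
  qed
  ultimately have "Determinant.det A = of_real (sqrt (r d * r n)) * ?I" by simp
  then show ?thesis
    by (simp only: bordered_toeplitz_det_def A_def csqrt flip: d_def)
qed

theorem corollary1p11:
  fixes m n :: nat
  assumes "1 \<le> m" and "m < n"
  shows
    "(\<forall>(\<mu> :: real measure) (\<nu> :: nat \<Rightarrow> real set \<Rightarrow> complex).
        sets \<mu> = sets borel \<longrightarrow>
        (\<forall>k::nat. integrable \<mu> (\<lambda>x. x ^ k)) \<longrightarrow>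
        (\<forall>k\<in>{n - m..n - 1}. hankel_det \<mu> k \<noteq> 0) \<longrightarrow>
        (\<forall>j\<in>{1..m}. complex_measure borel (\<nu> j) \<and>
           (\<forall>k::nat. cm_integrable borel (\<nu> j) (\<lambda>x. complex_of_real x ^ k))) \<longrightarrow>
        bordered_hankel_det \<mu> \<nu> m n =
          complex_of_real (hankel_det \<mu> (n - m)) *
          iterated_integral borel \<nu> m (\<lambda>z.
            Determinant.det (Matrix.mat m m (\<lambda>(i, j).
              complex_of_real (poly (orth_poly \<mu> (n - m + i)) (z (j + 1)))))))
     \<and>
     (\<forall>(\<phi> :: complex measure) (\<psi> :: nat \<Rightarrow> complex set \<Rightarrow> complex).
        sets \<phi> = sets circle_borel \<longrightarrow>
        finite_measure \<phi> \<longrightarrow>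
        (\<forall>k\<in>{n - m..n}. toeplitz_det \<phi> k \<noteq> 0) \<longrightarrow>
        (\<forall>j\<in>{1..m}. complex_measure circle_borel (\<psi> j)) \<longrightarrow>
        bordered_toeplitz_det \<phi> \<psi> m n =
          csqrt (toeplitz_det \<phi> (n - m) * toeplitz_det \<phi> n) *
          iterated_integral circle_borel \<psi> m (\<lambda>z.
            Determinant.det (Matrix.mat m m (\<lambda>(i, j).
              circle_poly \<phi> (n - m + i) (z (j + 1)))) *
            (\<Prod>j=1..m. z j powi (- int n + 1))))"
proof (intro conjI allI impI)
  fix \<mu> :: "real measure" and \<nu> :: "nat \<Rightarrow> real set \<Rightarrow> complex"
  assume "\<forall>k::nat. integrable \<mu> (\<lambda>x. x ^ k)"
    and "\<forall>k\<in>{n - m..n - 1}. hankel_det \<mu> k \<noteq> 0"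
    and "\<forall>j\<in>{1..m}. complex_measure borel (\<nu> j) \<and>
      (\<forall>k::nat. cm_integrable borel (\<nu> j) (\<lambda>x. complex_of_real x ^ k))"
  with assms show "bordered_hankel_det \<mu> \<nu> m n =
      complex_of_real (hankel_det \<mu> (n - m)) *
      iterated_integral borel \<nu> m (\<lambda>z.
        Determinant.det (Matrix.mat m m (\<lambda>(i, j).
          complex_of_real (poly (orth_poly \<mu> (n - m + i)) (z (j + 1))))))"
    by (intro bordered_hankel_det_eq_iterated_integral) auto
next
  fix \<phi> :: "complex measure" and \<psi> :: "nat \<Rightarrow> complex set \<Rightarrow> complex"
  assume "sets \<phi> = sets circle_borel" "finite_measure \<phi>"
    and "\<forall>k\<in>{n - m..n}. toeplitz_det \<phi> k \<noteq> 0"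
    and "\<forall>j\<in>{1..m}. complex_measure circle_borel (\<psi> j)"
  with assms show "bordered_toeplitz_det \<phi> \<psi> m n =
      csqrt (toeplitz_det \<phi> (n - m) * toeplitz_det \<phi> n) *
      iterated_integral circle_borel \<psi> m (\<lambda>z.
        Determinant.det (Matrix.mat m m (\<lambda>(i, j).
          circle_poly \<phi> (n - m + i) (z (j + 1)))) *
        (\<Prod>j=1..m. z j powi (- int n + 1)))"
    by (intro bordered_toeplitz_det_eq_iterated_integral) auto
qed

end
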